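(* Let $J_T=\{(j,t): j\in J,\ t\in T(j)\}$. For every $J_T'\subseteq J_T$ and every integer $\gamma\ge 1$, the inequality $$\sum_{(j,t)\in J_T^1\cup J_T^3}u_{jt}\le \bar k+\gamma-1$$ is valid for the formulation (SL-MCFLP), i.e. it is satisfied by every feasible solution $(x,y,u)$, where: - $\delta_{(1)}\le\delta_{(2)}\le\dots\le\delta_{(|J_T'|)}$ are the costs $c_{jt}$, $(j,t)\in J_T'$, sorted in non-decreasing order (with repetitions); - $\bar k$ is the largest index in $\{0,1,\dots,|J_T'|\}$ such that $\sum_{h=1}^{\bar k}\delta_{(h)}\le B$; - $\bar c=\max\left\{\dfrac{B-\sum_{h=1}^{\bar k}\delta_{(h)}}{\gamma},\ \delta_{(\bar k)}\right\}$ (with the convention $\delta_{(0)}=0$); - $J_T^1=\{(j,t)\in J_T:\ \exists\, t'\le t \text{ with } (j,t')\in J_T'\}$; - $J_T^3=\{(j,t)\in J_T\setminus J_T^1:\ c_{jt}>\bar c\}$.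
   Context: Data. $I$ (clients), $J$ (potential second-level facilities), $M$ (products), $S$ (first-level facilities) are finite sets. Each $s\in S$ offers one product $m(s)\in M$. $M_I(i)\subseteq M$ is the set of products demanded by client $i$. $d_{sj}$ and $d_{ji}$ are distances between $s\in S$ and $j\in J$, and between $j\in J$ and $i\in I$; $R_m, r_m$ are covering radii for each $m\in M$. For $j\in J$, $b_j$ is a nonnegative integer (maximum number of different products $j$ can offer), and $T(j)=\{0,1,\dots,b_j\}$. $w_{is}$ is the (real) satisfaction of client $i$ when served product $m(s)$ from $s$; $c_{jt}\ge 0$ is the cost of offering $t\in T(j)$ different products at $j$, with $c_{jt}\le c_{j,t+1}$ whenever $t,t+1\in T(j)$; $B\ge 0$ is the budget. Derived sets. - $J(i,s)=\{j\in J: d_{ji}\le r_{m(s)},\ d_{sj}\le R_{m(s)}\}$. - $S_M(m)=\{s\in S: m(s)=m\}$. - $M_J(j)=\{m\in M:\exists s\in S \text{ with } m(s)=m,\ d_{sj}\le R_m\}$. - $S_I(i)=\{s\in S: m(s)\in M_I(i),\ J(i,s)\ne\emptyset\}$. Formulation (SL-MCFLP). Variables $y_{is}$ ($i\in I, s\in S_I(i)$), $x_{jm}$ ($j\in J, m\in M_J(j)$), $u_{jt}$ ($j\in J,t\in T(j)$): $$\max \sum_{i\in I}\sum_{s\in S_I(i)} w_{is}y_{is}$$ subject to - $\sum_{j\in J(i,s)}x_{jm(s)}\ge y_{is}$ for $i\in I, s\in S_I(i)$; - $\sum_{s\in S_I(i)\cap S_M(m)}y_{is}\le 1$ for $i\in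 I, m\in M_I(i)$; - $\sum_{m\in M_J(j)}x_{jm}=\sum_{t\in T(j)}t\,u_{jt}$ for $j\in J$; - $\sum_{t\in T(j)}u_{jt}=1$ for $j\in J$; - $\sum_{j\in J}\sum_{t\in T(j)}c_{jt}u_{jt}\le B$; - $y_{is}\in\{0,1\}$, $x_{jm}\in\{0,1\}$, $u_{jt}\in\{0,1\}$ for all indices. *)

theory Defs
  imports Complex_Main "HOL-Library.Multiset"
begin

record ('i, 'j, 'm, 's) mcflp_data =
  clients       :: "'i set"                     (* I *)
  facilities    :: "'j set"                     (* J *)
  products      :: "'m set"                     (* M *)
  suppliers     :: "'s set"                     (* S, the first-level facilities *)
  product_of    :: "'s \<Rightarrow> 'm"                  (* m(s) *)
  demand        :: "'i \<Rightarrow> 'm set"              (* M_I(i) *)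
  dist_SJ       :: "'s \<Rightarrow> 'j \<Rightarrow> real"          (* d_sj *)
  dist_JI       :: "'j \<Rightarrow> 'i \<Rightarrow> real"          (* d_ji *)
  radius_SJ     :: "'m \<Rightarrow> real"                (* R_m *)
  radius_JI     :: "'m \<Rightarrow> real"                (* r_m *)
  max_offer     :: "'j \<Rightarrow> nat"                 (* b_j *)
  satisfaction  :: "'i \<Rightarrow> 's \<Rightarrow> real"          (* w_is *)
  offer_cost    :: "'j \<Rightarrow> nat \<Rightarrow> real"         (* c_jt *)
  budget        :: real                         (* B *)

definition T_J :: "('i, 'j, 'm, 's) mcflp_data \<Rightarrow> 'j \<Rightarrow> nat set" where
  "T_J P j = {0..max_offer P j}"

locale sl_mcflp =
  fixes P :: "('i, 'j, 'm, 's) mcflp_data"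
  assumes finite_clients: "finite (clients P)"
    and finite_facilities: "finite (facilities P)"
    and finite_products: "finite (products P)"
    and finite_suppliers: "finite (suppliers P)"
    and product_of_in: "\<And>s. s \<in> suppliers P \<Longrightarrow> product_of P s \<in> products P"
    and demand_subset: "\<And>i. i \<in> clients P \<Longrightarrow> demand P i \<subseteq> products P"
    and offer_cost_nonneg:
      "\<And>j t. j \<in> facilities P \<Longrightarrow> t \<in> T_J P j \<Longrightarrow> 0 \<le> offer_cost P j t"
    and offer_cost_mono:
      "\<And>j t. j \<in> facilities P \<Longrightarrow> t \<in> T_J P j \<Longrightarrow> t + 1 \<in> T_J P j \<Longrightarrow>
        offer_cost P j t \<le> offer_cost P j (t + 1)"
    and budget_nonneg: "0 \<le> budget P"

definition J_IS :: "('i, 'j, 'm, 's) mcflp_data \<Rightarrow> 'i \<Rightarrow> 's \<Rightarrow> 'j set" where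
  "J_IS P i s = {j \<in> facilities P.
     dist_JI P j i \<le> radius_JI P (product_of P s) \<and>
     dist_SJ P s j \<le> radius_SJ P (product_of P s)}"

definition S_M :: "('i, 'j, 'm, 's) mcflp_data \<Rightarrow> 'm \<Rightarrow> 's set" where
  "S_M P m = {s \<in> suppliers P. product_of P s = m}"

definition M_J :: "('i, 'j, 'm, 's) mcflp_data \<Rightarrow> 'j \<Rightarrow> 'm set" where
  "M_J P j = {m \<in> products P.
     \<exists>s \<in> suppliers P. product_of P s = m \<and> dist_SJ P s j \<le> radius_SJ P m}"

definition S_I :: "('i, 'j, 'm, 's) mcflp_data \<Rightarrow> 'i \<Rightarrow> 's set" where
  "S_I P i = {s \<in> suppliers P. product_of P s \<in> demand P i \<and> J_IS P i s \<noteq> {}}"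

definition J_T :: "('i, 'j, 'm, 's) mcflp_data \<Rightarrow> ('j \<times> nat) set" where
  "J_T P = {(j, t). j \<in> facilities P \<and> t \<in> T_J P j}"

text \<open>
  The decision variables are total functions; the formulation only constrains and uses
  their values on the index sets \<open>i \<in> I, s \<in> S_I(i)\<close> for \<open>y\<close>, \<open>j \<in> J, m \<in> M_J(j)\<close> for \<open>x\<close>
  and \<open>j \<in> J, t \<in> T(j)\<close> for \<open>u\<close>.
\<close>

definition feasible :: "('i, 'j, 'm, 's) mcflp_data \<Rightarrow> ('j \<Rightarrow> 'm \<Rightarrow> real) \<Rightarrow>
    ('i \<Rightarrow> 's \<Rightarrow> real) \<Rightarrow> ('j \<Rightarrow> nat \<Rightarrow> real) \<Rightarrow> bool" where
  "feasible P x y u \<longleftrightarrow>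
     (\<forall>i \<in> clients P. \<forall>s \<in> S_I P i. (\<Sum>j \<in> J_IS P i s. x j (product_of P s)) \<ge> y i s) \<and>
     (\<forall>i \<in> clients P. \<forall>m \<in> demand P i. (\<Sum>s \<in> S_I P i \<inter> S_M P m. y i s) \<le> 1) \<and>
     (\<forall>j \<in> facilities P. (\<Sum>m \<in> M_J P j. x j m) = (\<Sum>t \<in> T_J P j. real t * u j t)) \<and>
     (\<forall>j \<in> facilities P. (\<Sum>t \<in> T_J P j. u j t) = 1) \<and>
     (\<Sum>j \<in> facilities P. \<Sum>t \<in> T_J P j. offer_cost P j t * u j t) \<le> budget P \<and>
     (\<forall>i \<in> clients P. \<forall>s \<in> S_I P i. y i s \<in> {0, 1}) \<and>
     (\<forall>j \<in> facilities P. \<forall>m \<in> M_J P j. x j m \<in> {0, 1}) \<and>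
     (\<forall>j \<in> facilities P. \<forall>t \<in> T_J P j. u j t \<in> {0, 1})"

text \<open>The objective is to be maximised over the feasible solutions; validity of an
  inequality depends on feasibility alone.\<close>

definition objective :: "('i, 'j, 'm, 's) mcflp_data \<Rightarrow> ('i \<Rightarrow> 's \<Rightarrow> real) \<Rightarrow> real" where
  "objective P y = (\<Sum>i \<in> clients P. \<Sum>s \<in> S_I P i. satisfaction P i s * y i s)"

text \<open>
  \<open>sorted_cost P A h\<close> is \<open>\<delta>\<^sub>(\<^sub>h\<^sub>)\<close>, the \<open>h\<close>-th smallest cost (counted from 1, with repetitions)
  over \<open>A\<close>, with \<open>\<delta>\<^sub>(\<^sub>0\<^sub>) = 0\<close>. It is meaningful only for finite \<open>A\<close> and \<open>h \<le> card A\<close>.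
\<close>

definition sorted_cost ::
    "('i, 'j, 'm, 's) mcflp_data \<Rightarrow> ('j \<times> nat) set \<Rightarrow> nat \<Rightarrow> real" where
  "sorted_cost P A h =
     (if h = 0 then 0
      else sorted_list_of_multiset (image_mset (\<lambda>(j, t). offer_cost P j t) (mset_set A)) ! (h - 1))"

definition k_bar :: "('i, 'j, 'm, 's) mcflp_data \<Rightarrow> ('j \<times> nat) set \<Rightarrow> nat" where
  "k_bar P A = Max {k \<in> {0..card A}. (\<Sum>h = 1..k. sorted_cost P A h) \<le> budget P}"

definition c_bar :: "('i, 'j, 'm, 's) mcflp_data \<Rightarrow> ('j \<times> nat) set \<Rightarrow> int \<Rightarrow> real" where
  "c_bar P A \<gamma> =
     max ((budget P - (\<Sum>h = 1..k_bar P A. sorted_cost P A h)) / of_int \<gamma>)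
         (sorted_cost P A (k_bar P A))"

definition J_T1 :: "('i, 'j, 'm, 's) mcflp_data \<Rightarrow> ('j \<times> nat) set \<Rightarrow> ('j \<times> nat) set" where
  "J_T1 P A = {(j, t) \<in> J_T P. \<exists>t' \<le> t. (j, t') \<in> A}"

definition J_T3 ::
    "('i, 'j, 'm, 's) mcflp_data \<Rightarrow> ('j \<times> nat) set \<Rightarrow> int \<Rightarrow> ('j \<times> nat) set" where
  "J_T3 P A \<gamma> = {(j, t) \<in> J_T P - J_T1 P A. offer_cost P j t > c_bar P A \<gamma>}"

end

theory Submission
  imports Defs
begin

text \<open>
  A feasible solution selects exactly one level \<open>t\<close> per facility \<open>j\<close>. Let \<open>p\<close> and \<open>q\<close> be the
  numbers of selected pairs in \<open>J\<^sub>T\<^sup>1\<close> and \<open>J\<^sub>T\<^sup>3\<close>. Lowering each of the former to a pair of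
  \<open>J\<^sub>T'\<close> gives \<open>p\<close> distinct pairs without raising the costs, so these cost at least
  \<open>\<delta>\<^sub>(\<^sub>1\<^sub>) + \<dots> + \<delta>\<^sub>(\<^sub>p\<^sub>)\<close>, and hence \<open>p \<le> k\<close>
  for \<open>k = k_bar\<close>. If \<open>p + q \<ge> k + \<gamma>\<close>, then \<open>k - p\<close> of the pairs in \<open>J\<^sub>T\<^sup>3\<close> pay for
  \<open>\<delta>\<^sub>(\<^sub>p\<^sub>+\<^sub>1\<^sub>) + \<dots> + \<delta>\<^sub>(\<^sub>k\<^sub>)\<close>, and \<open>\<gamma>\<close> further ones cost strictly more than the remaining budget.
\<close>

section \<open>Smallest entries of sorted lists\<close>

text \<open>Induction on \<open>xs\<close>, removing the heads of both lists: the head of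
  \<open>xs\<close> is minimal, hence at most that of \<open>ys\<close>, and the inclusion of
  multisets passes to the tails.\<close>

lemma sum_list_take_sorted_le:
  fixes xs ys :: "'a::{linorder, ordered_comm_monoid_add} list"
  assumes "sorted xs" "sorted ys" "mset ys \<subseteq># mset xs"
  shows "sum_list (take (length ys) xs) \<le> sum_list ys"
  using assms
proof (induction xs arbitrary: ys)
  case Nil
  then show ?case by simp
next
  case (Cons a xs)
  show ?case
  proof (cases ys)
    case Nil
    then show ?thesis by simp
  next
    case (Cons b zs)
    have "b \<in> set (a # xs)"
      using Cons.prems(3) Cons by (metis list.set_intros(1) mset_subset_eqD set_mset_mset)
    then have "a \<le> b"
      using Cons.prems(1) by auto
    have "mset zs \<subseteq># mset xs"
    proof (cases "a = b")
      case True
      then show ?thesis using Cons.prems(3) Cons by simp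
    next
      \<comment> \<open>Here \<open>a\<close> lies strictly below the least entry of
        \<open>ys\<close>, so deleting \<open>a\<close> from \<open>xs\<close> does not disturb the
        inclusion.\<close>
      case False
      then have "a \<notin># mset ys"
        using Cons.prems(2) Cons \<open>a \<le> b\<close> by auto
      then have "mset ys \<subseteq># mset xs"
        using Cons.prems(3)
        by (metis Diff_eq_empty_iff_mset minus_add_mset_if_not_in_lhs mset.simps(2))
      then show ?thesis
        using Cons mset_subset_eq_insertD[of b "mset zs"] by (simp add: subset_mset.less_imp_le)
    qed
    then have "sum_list (take (length zs) xs) \<le> sum_list zs"
      using Cons.IH Cons.prems Cons by simp
    then show ?thesis
      using Cons \<open>a \<le> b\<close> by (simp add: add_mono)
  qed
qed

text \<open>The list that \<open>sorted_cost\<close> indexes from 1; partial sums of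
  \<open>sorted_cost\<close> become sums of its prefixes.\<close>

definition sorted_costs :: "('i, 'j, 'm, 's) mcflp_data \<Rightarrow> ('j \<times> nat) set \<Rightarrow> real list" where
  "sorted_costs P A =
     sorted_list_of_multiset (image_mset (\<lambda>(j, t). offer_cost P j t) (mset_set A))"

lemma length_sorted_costs [simp]: "length (sorted_costs P A) = card A"
  by (metis mset_sorted_list_of_multiset size_image_mset size_mset size_mset_set sorted_costs_def)

lemma sorted_sorted_costs [simp]: "sorted (sorted_costs P A)"
  by (simp add: sorted_costs_def)

lemma sum_sorted_cost:
  assumes "k \<le> card A"
  shows "(\<Sum>h = 1..k. sorted_cost P A h) = sum_list (take k (sorted_costs P A))"
proof -
  have "(\<Sum>h = 1..k. sorted_cost P A h) = (\<Sum>h<k. sorted_costs P A ! h)"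
    by (rule sum.reindex_bij_witness[of _ Suc "\<lambda>h. h - 1"])
       (auto simp: sorted_cost_def sorted_costs_def)
  also have "\<dots> = sum_list (take k (sorted_costs P A))"
    using assms by (simp add: sum_list_sum_nth min_absorb2 atLeast0LessThan)
  finally show ?thesis .
qed

text \<open>The costs over \<open>X\<close> form a submultiset of those over \<open>A\<close>, so
  the comparison of sorted lists applies.\<close>

lemma sum_sorted_cost_le:
  assumes "finite A" "X \<subseteq> A"
  shows "(\<Sum>h = 1..card X. sorted_cost P A h) \<le> (\<Sum>(j, t)\<in>X. offer_cost P j t)"
proof -
  have "mset_set X \<subseteq># mset_set A"
    using assms by (simp add: finite_subset subset_imp_msubset_mset_set)
  then have "mset (sorted_costs P X) \<subseteq># mset (sorted_costs P A)"
    by (simp add: sorted_costs_def image_mset_subseteq_mono)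
  then have "sum_list (take (card X) (sorted_costs P A)) \<le> sum_list (sorted_costs P X)"
    using sum_list_take_sorted_le[of "sorted_costs P A" "sorted_costs P X"] by simp
  also have "sum_list (sorted_costs P X) = (\<Sum>(j, t)\<in>X. offer_cost P j t)"
    by (metis mset_sorted_list_of_multiset sorted_costs_def sum_mset_sum_list sum_unfold_sum_mset)
  finally show ?thesis
    using sum_sorted_cost[OF card_mono[OF assms], of P] by simp
qed

text \<open>Index 0 is left out: its value 0 is a convention and not an entry of the sorted
  list.\<close>

lemma sorted_cost_mono:
  assumes "1 \<le> h" "h \<le> k" "k \<le> card A"
  shows "sorted_cost P A h \<le> sorted_cost P A k"
  using assms sorted_nth_mono[OF sorted_sorted_costs[of P A], of "h - 1" "k - 1"]
  by (auto simp: sorted_cost_def sorted_costs_def[symmetric])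

section \<open>Pairs selected by a feasible solution\<close>

text \<open>For feasible \<open>u\<close> this is the support of \<open>u\<close> on
  \<open>J_T P\<close>, which turns sums of \<open>u\<close> into cardinalities.\<close>

definition selected :: "('i, 'j, 'm, 's) mcflp_data \<Rightarrow> ('j \<Rightarrow> nat \<Rightarrow> real) \<Rightarrow> ('j \<times> nat) set" where
  "selected P u = {(j, t) \<in> J_T P. u j t = 1}"

context sl_mcflp
begin

lemma J_T_Sigma: "J_T P = Sigma (facilities P) (T_J P)"
  by (auto simp: J_T_def)

lemma finite_J_T: "finite (J_T P)"
  unfolding J_T_Sigma using finite_facilities by (auto simp: T_J_def)

lemma offer_cost_le:
  assumes "j \<in> facilities P" "t' \<le> t" "t \<in> T_J P j"
  shows "offer_cost P j t' \<le> offer_cost P j t"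
  using assms(2,3)
proof (induction t rule: dec_induct)
  case base
  then show ?case by simp
next
  case (step n)
  then have "n \<in> T_J P j" by (auto simp: T_J_def)
  then show ?case
    using step offer_cost_mono[OF assms(1), of n] by auto
qed

lemma k_bar_props:
  fixes A
  shows k_bar_le_card: "k_bar P A \<le> card A"
    and sum_k_bar_le: "(\<Sum>h = 1..k_bar P A. sorted_cost P A h) \<le> budget P"
    and k_bar_greatest: "\<And>k. k \<le> card A \<Longrightarrow> (\<Sum>h = 1..k. sorted_cost P A h) \<le> budget P \<Longrightarrow> k \<le> k_bar P A"
proof -
  let ?K = "{k \<in> {0..card A}. (\<Sum>h = 1..k. sorted_cost P A h) \<le> budget P}"
  \<comment> \<open>The empty sum fits into the nonnegative budget, so the maximum is taken over a
    nonempty set.\<close>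
  have "0 \<in> ?K" using budget_nonneg by simp
  then have "Max ?K \<in> ?K" by (intro Max_in) auto
  then show "k_bar P A \<le> card A" "(\<Sum>h = 1..k_bar P A. sorted_cost P A h) \<le> budget P"
    by (auto simp: k_bar_def)
  show "k \<le> k_bar P A" if "k \<le> card A" "(\<Sum>h = 1..k. sorted_cost P A h) \<le> budget P" for k
    unfolding k_bar_def using that by (intro Max_ge) auto
qed

lemma finite_selected: "finite (selected P u)"
  by (rule finite_subset[OF _ finite_J_T]) (auto simp: selected_def)

lemma feasible_binary:
  assumes "feasible P x y u" "(j, t) \<in> J_T P"
  shows "u j t = (if (j, t) \<in> selected P u then 1 else 0)"
  using assms by (auto simp: feasible_def J_T_def selected_def)

lemma sum_feasible_eq_card:
  assumes "feasible P x y u" "F \<subseteq> J_T P"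
  shows "(\<Sum>(j, t)\<in>F. u j t) = real (card (F \<inter> selected P u))"
proof -
  have "finite F" using assms(2) finite_J_T finite_subset by blast
  have "(\<Sum>(j, t)\<in>F. u j t) = (\<Sum>e\<in>F. if e \<in> selected P u then 1 else 0)"
    using assms by (intro sum.cong) (auto simp: feasible_binary split: prod.splits)
  then show ?thesis
    using \<open>finite F\<close> by (simp flip: sum.inter_restrict)
qed

lemma selected_cost_le_budget:
  assumes "feasible P x y u"
  shows "(\<Sum>(j, t)\<in>selected P u. offer_cost P j t) \<le> budget P"
proof -
  have "(\<Sum>(j, t)\<in>selected P u. offer_cost P j t) = (\<Sum>(j, t)\<in>J_T P. offer_cost P j t * u j t)"
    using finite_J_T feasible_binary[OF assms]
    by (intro sum.mono_neutral_cong_left) (auto simp: selected_def, metis)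
  also have "\<dots> = (\<Sum>j\<in>facilities P. \<Sum>t\<in>T_J P j. offer_cost P j t * u j t)"
    unfolding J_T_Sigma using finite_facilities by (subst sum.Sigma) (auto simp: T_J_def)
  also have "\<dots> \<le> budget P"
    using assms by (simp add: feasible_def)
  finally show ?thesis .
qed

text \<open>Two selected levels at one facility would contribute 2 to a sum of nonnegative terms
  that must equal 1.\<close>

lemma inj_on_fst_selected:
  assumes "feasible P x y u"
  shows "inj_on fst (selected P u)"
proof (rule inj_onI, rule ccontr)
  fix e e' assume e: "e \<in> selected P u" "e' \<in> selected P u" "fst e = fst e'" "e \<noteq> e'"
  then obtain j t t' where jt: "e = (j, t)" "e' = (j, t')" "t \<noteq> t'"
    by (metis prod.collapse)
  have j: "j \<in> facilities P" "t \<in> T_J P j" "t' \<in> T_J P j" "u j t = 1" "u j t' = 1"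
    using e jt by (auto simp: selected_def J_T_def)
  have "(\<Sum>r\<in>{t, t'}. u j r) \<le> (\<Sum>r\<in>T_J P j. u j r)"
  proof (rule sum_mono2)
    show "0 \<le> u j r" if "r \<in> T_J P j - {t, t'}" for r
      using feasible_binary[OF assms, of j r] that j(1) by (auto simp: J_T_def)
  qed (use j in \<open>auto simp: T_J_def\<close>)
  then show False
    using assms j jt by (simp add: feasible_def)
qed

section \<open>Counting selected pairs against the budget\<close>

lemma sum_sorted_cost_le_selected:
  assumes "feasible P x y u" "A \<subseteq> J_T P" "X \<subseteq> J_T1 P A \<inter> selected P u"
  shows "card X \<le> card A"
    and "(\<Sum>h = 1..card X. sorted_cost P A h) \<le> (\<Sum>(j, t)\<in>X. offer_cost P j t)"
proof -
  have fin: "finite A" using assms(2) finite_J_T finite_subset by blast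
  have "\<forall>e\<in>X. \<exists>t'\<le>snd e. (fst e, t') \<in> A"
    using assms(3) by (fastforce simp: J_T1_def)
  then obtain g where g: "\<And>e. e \<in> X \<Longrightarrow> g e \<le> snd e \<and> (fst e, g e) \<in> A"
    by metis
  \<comment> \<open>The lowering map keeps the facility, and selected pairs have distinct
    facilities, so it is injective on \<open>X\<close>.\<close>
  define f where "f e = (fst e, g e)" for e
  have inj: "inj_on f X"
    using inj_on_fst_selected[OF assms(1)] assms(3) by (auto simp: f_def inj_on_def)
  have sub: "f ` X \<subseteq> A" using g by (auto simp: f_def)
  have card: "card (f ` X) = card X" using inj by (rule card_image)
  show "card X \<le> card A" using card_mono[OF fin sub] card by simp
  have "(\<Sum>h = 1..card X. sorted_cost P A h) \<le> (\<Sum>(j, t)\<in>f ` X. offer_cost P j t)"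
    using sum_sorted_cost_le[OF fin sub] card by simp
  also have "\<dots> = (\<Sum>e\<in>X. offer_cost P (fst e) (g e))"
    by (subst sum.reindex[OF inj]) (simp add: f_def)
  also have "\<dots> \<le> (\<Sum>(j, t)\<in>X. offer_cost P j t)"
    unfolding case_prod_unfold using g assms(3)
    by (intro sum_mono offer_cost_le) (auto simp: J_T1_def J_T_def)
  finally show "(\<Sum>h = 1..card X. sorted_cost P A h) \<le> (\<Sum>(j, t)\<in>X. offer_cost P j t)" .
qed

lemma card_selected_lt:
  fixes \<gamma> :: int
  assumes feas: "feasible P x y u" and A: "A \<subseteq> J_T P" and \<gamma>: "\<gamma> \<ge> 1"
  defines "X \<equiv> J_T1 P A \<inter> selected P u" and "Y \<equiv> J_T3 P A \<gamma> \<inter> selected P u"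
  shows "int (card X) + int (card Y) < int (k_bar P A) + \<gamma>"
proof (rule ccontr)
  assume neg: "\<not> ?thesis"
  define p q k c D where "p = card X" and "q = card Y" and "k = k_bar P A" and "c = c_bar P A \<gamma>"
    and "D = (\<lambda>k. \<Sum>h = 1..k. sorted_cost P A h)"
  have big: "int p + int q \<ge> int k + \<gamma>"
    using neg by (simp add: p_def q_def k_def)
  have fin: "finite X" "finite Y"
    by (auto simp: X_def Y_def finite_selected)
  have disj: "X \<inter> Y = {}"
    by (auto simp: X_def Y_def J_T3_def)
  have "(\<Sum>(j, t)\<in>X \<union> Y. offer_cost P j t) \<le> (\<Sum>(j, t)\<in>selected P u. offer_cost P j t)"
    by (intro sum_mono2 finite_selected)
       (auto simp: X_def Y_def selected_def J_T_def offer_cost_nonneg)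
  then have budget: "(\<Sum>(j, t)\<in>X. offer_cost P j t) + (\<Sum>(j, t)\<in>Y. offer_cost P j t) \<le> budget P"
    using selected_cost_le_budget[OF feas] fin disj by (simp add: sum.union_disjoint)
  have "X \<subseteq> J_T1 P A \<inter> selected P u" by (simp add: X_def)
  note X = sum_sorted_cost_le_selected[OF feas A this]
  \<comment> \<open>Since \<open>Y\<close> has nonnegative cost, \<open>X\<close> alone fits into
    the budget; maximality of \<open>k_bar\<close> then bounds \<open>p\<close>.\<close>
  have "0 \<le> (\<Sum>(j, t)\<in>Y. offer_cost P j t)"
    by (intro sum_nonneg) (auto simp: Y_def selected_def J_T_def offer_cost_nonneg)
  then have "p \<le> k"
    unfolding p_def k_def using X budget by (intro k_bar_greatest) auto
  have c: "c \<ge> (budget P - D k) / of_int \<gamma>" "c \<ge> sorted_cost P A k"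
    by (simp_all add: c_def c_bar_def D_def k_def)
  \<comment> \<open>The sign of \<open>c\<close> matters later, when the factor
    \<open>k - p + \<gamma>\<close> is enlarged to \<open>q\<close>.\<close>
  have "0 \<le> (budget P - D k) / of_int \<gamma>"
    using sum_k_bar_le[of A] \<gamma> by (simp add: D_def k_def)
  with c have "c \<ge> 0" by linarith
  have "q > 0" using big \<open>p \<le> k\<close> \<gamma> by linarith
  then have "Y \<noteq> {}" by (auto simp: q_def)
  have "{1..k} = {1..p} \<union> {Suc p..k}" using \<open>p \<le> k\<close> by auto
  then have "D k = D p + (\<Sum>h = Suc p..k. sorted_cost P A h)"
    unfolding D_def by (simp add: sum.union_disjoint)
  \<comment> \<open>Each of these costs is at most the \<open>k\<close>-th one, which
    \<open>c\<close> dominates by the second term of its maximum.\<close>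
  also have "(\<Sum>h = Suc p..k. sorted_cost P A h) \<le> (\<Sum>h = Suc p..k. c)"
    using c(2) k_bar_le_card[of A]
    by (intro sum_mono order_trans[OF sorted_cost_mono c(2)]) (auto simp: k_def)
  also have "\<dots> = (real k - real p) * c"
    using \<open>p \<le> k\<close> by simp
  finally have Dk: "D k \<le> D p + (real k - real p) * c" by simp
  have "budget P - D k \<le> of_int \<gamma> * c"
    using c(1) \<gamma> by (simp add: field_simps)
  \<comment> \<open>Of the copies of \<open>c\<close>, \<open>k - p\<close> cover the sorted costs
    after the \<open>p\<close>-th, and \<open>\<gamma>\<close> cover the budget left after the
    \<open>k\<close>-th.\<close>
  with Dk have "budget P \<le> D p + (real k - real p + of_int \<gamma>) * c"
    by (simp add: algebra_simps)
  also have "\<dots> \<le> D p + real q * c"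
    using big \<open>c \<ge> 0\<close> by (intro add_left_mono mult_right_mono) linarith+
  also have "real q * c = (\<Sum>e\<in>Y. c)" by (simp add: q_def)
  \<comment> \<open>Strict because \<open>Y\<close> is nonempty and each of its pairs costs more
    than \<open>c\<close>.\<close>
  also have "\<dots> < (\<Sum>(j, t)\<in>Y. offer_cost P j t)"
    using fin \<open>Y \<noteq> {}\<close> by (intro sum_strict_mono) (auto simp: Y_def J_T3_def c_def)
  finally show False
    using X(2) budget by (simp add: D_def p_def)
qed

end

theorem corollary3p1:
  fixes P :: "('i, 'j, 'm, 's) mcflp_data"
    and JT' :: "('j \<times> nat) set"
    and \<gamma> :: int
  assumes "sl_mcflp P"
    and "JT' \<subseteq> J_T P"
    and "\<gamma> \<ge> 1"
  shows "\<forall>x y u. feasible P x y u \<longrightarrow>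
    (\<Sum>(j, t) \<in> J_T1 P JT' \<union> J_T3 P JT' \<gamma>. u j t) \<le> real (k_bar P JT') + of_int \<gamma> - 1"
proof (intro allI impI)
  fix x y u assume feas: "feasible P x y u"
  interpret sl_mcflp P by fact
  let ?X = "J_T1 P JT' \<inter> selected P u" and ?Y = "J_T3 P JT' \<gamma> \<inter> selected P u"
  have "(\<Sum>(j, t) \<in> J_T1 P JT' \<union> J_T3 P JT' \<gamma>. u j t)
      = real (card ((J_T1 P JT' \<union> J_T3 P JT' \<gamma>) \<inter> selected P u))"
    by (intro sum_feasible_eq_card[OF feas]) (auto simp: J_T1_def J_T3_def)
  also have "\<dots> = real (card (?X \<union> ?Y))"
    by (simp add: Int_Un_distrib2)
  also have "\<dots> \<le> real (card ?X) + real (card ?Y)"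
    using card_Un_le[of ?X ?Y] by linarith
  \<comment> \<open>The strict bound is between integers, which yields the
    \<open>- 1\<close>.\<close>
  also have "\<dots> \<le> real (k_bar P JT') + of_int \<gamma> - 1"
    using card_selected_lt[OF feas assms(2,3)] by linarith
  finally show "(\<Sum>(j, t) \<in> J_T1 P JT' \<union> J_T3 P JT' \<gamma>. u j t)
      \<le> real (k_bar P JT') + of_int \<gamma> - 1" .
qed

end
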